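(* If $R$ is a graph on $s$ vertices, then \[ \phi(R)\le\phi(K_s)=s(2^{s-1}-1). \]
   Context: Graphs are finite and simple. For a graph $R$ and nonempty $I\subseteq V(R)$, $\delta_I=\min\{d_R(x):x\in I\}$, and the fixed loss of $R$ is \[ \phi(R)=\sum_{\substack{I \text{ independent in } R\\ I\neq\emptyset}}\bigl(2^{\delta_I}-1\bigr). \] $K_s$ is the complete graph on $s$ vertices. *)

theory Defs
  imports "Graph_Theory.Kuratowski"
begin

text \<open>
  A finite simple graph is a \<^locale>\<open>graph\<close>: a finite, loop-free, symmetric digraph without
  parallel arcs, each edge \<open>uv\<close> being represented by the two arcs \<open>u \<rightarrow> v\<close> and \<open>v \<rightarrow> u\<close>.
  The degree of a vertex is therefore its out-degree, i.e. its number of neighbours.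
\<close>

lemma (in graph) out_degree_eq_card_neighbours:
  "out_degree G v = card {w. v \<rightarrow>\<^bsub>G\<^esub> w}"
proof -
  have "inj_on (head G) (out_arcs G v)"
    by (auto intro!: inj_onI no_multi_arcs simp: arc_to_ends_def)
  moreover have "head G ` out_arcs G v = {w. v \<rightarrow>\<^bsub>G\<^esub> w}"
    by (auto simp: arcs_ends_def arc_to_ends_def)
  ultimately show ?thesis
    unfolding out_degree_def by (metis card_image)
qed

text \<open>
  The complete graph \<open>K\<^sub>s\<close> is given by the predicate \<^const>\<open>complete_digraph\<close>, which is
  satisfiable for every \<open>s\<close>.
\<close>

lemma complete_digraph_exists: "\<exists>K :: (nat, nat \<times> nat) pre_digraph. K\<^bsub>s\<^esub> K"
proof
  show "K\<^bsub>s\<^esub> (with_proj \<lparr>pverts = {..<s}, parcs = {(u, v). u < s \<and> v < s \<and> u \<noteq> v}\<rparr>)"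
    by (auto simp: complete_digraph_pair_def)
qed

definition independent_set :: "('a, 'b) pre_digraph \<Rightarrow> 'a set \<Rightarrow> bool" where
  "independent_set R I \<longleftrightarrow> I \<subseteq> verts R \<and> (\<forall>u\<in>I. \<forall>v\<in>I. \<not> u \<rightarrow>\<^bsub>R\<^esub> v)"

definition min_degree_on :: "('a, 'b) pre_digraph \<Rightarrow> 'a set \<Rightarrow> nat" where
  "min_degree_on R I = Min (out_degree R ` I)"

definition fixed_loss :: "('a, 'b) pre_digraph \<Rightarrow> int" where
  "fixed_loss R = (\<Sum>I | independent_set R I \<and> I \<noteq> {}. 2 ^ min_degree_on R I - 1)"

end

theory Submission
  imports Defs
begin

text \<open>
  Count every nonempty independent set \<open>I\<close> once for each of its vertices; this only increases
  the loss. For a vertex \<open>v\<close> of degree \<open>d\<close>, an independent set containing \<open>v\<close> loses at most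
  \<open>2\<^bsup>d\<^esup> - 1\<close>, and its other vertices lie among the \<open>s - 1 - d\<close> non-neighbours of \<open>v\<close>. If there
  are \<open>N\<close> such sets, then \<open>1 \<le> N\<close> and \<open>N \<cdot> 2\<^bsup>d\<^esup> \<le> 2\<^bsup>s-1\<^esup>\<close>, so their total loss is at most
  \<open>N (2\<^bsup>d\<^esup> - 1) \<le> 2\<^bsup>s-1\<^esup> - 1\<close>. In \<open>K\<^sub>s\<close> only singletons contribute, and both steps are equalities.
\<close>

lemma sum_le_sum_related:
  fixes f :: "'i \<Rightarrow> 'm :: ordered_comm_monoid_add"
  assumes "finite S" and "finite T"
    and nonneg: "\<And>i. i \<in> S \<Longrightarrow> 0 \<le> f i"
    and related: "\<And>i. i \<in> S \<Longrightarrow> \<exists>j\<in>T. R i j"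
  shows "(\<Sum>i\<in>S. f i) \<le> (\<Sum>j\<in>T. \<Sum>i | i \<in> S \<and> R i j. f i)"
proof -
  have "f i \<le> (\<Sum>j | j \<in> T \<and> R i j. f i)" if "i \<in> S" for i
  proof -
    obtain j where "j \<in> T" "R i j"
      using related \<open>i \<in> S\<close> by blast
    then have "(\<Sum>j\<in>{j}. f i) \<le> (\<Sum>j | j \<in> T \<and> R i j. f i)"
      using \<open>finite T\<close> nonneg \<open>i \<in> S\<close> by (intro sum_mono2) auto
    then show ?thesis
      by simp
  qed
  then have "(\<Sum>i\<in>S. f i) \<le> (\<Sum>i\<in>S. \<Sum>j | j \<in> T \<and> R i j. f i)"
    by (rule sum_mono)
  also have "\<dots> = (\<Sum>j\<in>T. \<Sum>i | i \<in> S \<and> R i j. f i)"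
    using assms(1,2) by (rule sum.swap_restrict)
  finally show ?thesis .
qed

lemma (in fin_digraph) finite_independent_set: "independent_set G I \<Longrightarrow> finite I"
  unfolding independent_set_def using finite_subset[OF _ finite_verts] by blast

lemma (in fin_digraph) finite_independent_sets: "finite {I. independent_set G I \<and> P I}"
  by (rule finite_subset[of _ "Pow (verts G)"]) (auto simp: independent_set_def)

lemma (in loopfree_digraph) independent_set_singleton_iff:
  "independent_set G {v} \<longleftrightarrow> v \<in> verts G"
  using adj_not_same by (auto simp: independent_set_def)

lemma (in loopfree_digraph) neighbours_subset: "{w. v \<rightarrow>\<^bsub>G\<^esub> w} \<subseteq> verts G - {v}"
  using adj_not_same by (auto simp: adj_in_verts)

lemma min_degree_on_le:
  assumes "finite I" and "v \<in> I"
  shows "min_degree_on R I \<le> out_degree R v"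
  using assms by (simp add: min_degree_on_def)

lemma min_degree_on_singleton: "min_degree_on R {v} = out_degree R v"
  by (simp add: min_degree_on_def)

lemma (in graph) card_independent_sets_containing_mult_le:
  assumes "v \<in> verts G"
  shows "card {I. independent_set G I \<and> v \<in> I} * 2 ^ out_degree G v \<le> 2 ^ (card (verts G) - 1)"
proof -
  let ?A = "{I. independent_set G I \<and> v \<in> I}"
  let ?N = "{w. v \<rightarrow>\<^bsub>G\<^esub> w}"
  let ?W = "verts G - {v} - ?N"
  have "card ?A \<le> card (Pow ?W)"
  proof (rule card_inj_on_le)
    show "inj_on (\<lambda>I. I - {v}) ?A"
      by (auto simp: inj_on_def)
    show "(\<lambda>I. I - {v}) ` ?A \<subseteq> Pow ?W"
      by (auto simp: independent_set_def)
  qed simp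
  then have "card ?A * 2 ^ out_degree G v \<le> 2 ^ card ?W * 2 ^ card ?N"
    by (simp add: card_Pow out_degree_eq_card_neighbours)
  also have "\<dots> = 2 ^ card (?W \<union> ?N)"
    using finite_subset[OF neighbours_subset]
    by (subst card_Un_disjoint) (auto simp: power_add)
  also have "?W \<union> ?N = verts G - {v}"
    using neighbours_subset by blast
  finally show ?thesis
    using assms by simp
qed

lemma (in graph) loss_containing_le:
  assumes "v \<in> verts G"
  shows "(\<Sum>I | independent_set G I \<and> v \<in> I. 2 ^ min_degree_on G I - 1)
    \<le> (2 ^ (card (verts G) - 1) - 1 :: int)"
proof -
  let ?A = "{I. independent_set G I \<and> v \<in> I}"
  have "{v} \<in> ?A"
    using assms by (simp add: independent_set_singleton_iff)
  then have nonempty: "1 \<le> card ?A"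
    using finite_independent_sets by (auto simp: Suc_le_eq card_gt_0_iff)
  have "(\<Sum>I\<in>?A. 2 ^ min_degree_on G I - 1) \<le> (\<Sum>I\<in>?A. 2 ^ out_degree G v - 1 :: int)"
    by (intro sum_mono diff_right_mono power_increasing min_degree_on_le)
      (auto simp: finite_independent_set)
  also have "\<dots> = int (card ?A * 2 ^ out_degree G v) - int (card ?A)"
    by (simp add: right_diff_distrib)
  also have "\<dots> \<le> int (2 ^ (card (verts G) - 1)) - int 1"
    using card_independent_sets_containing_mult_le[OF assms] nonempty
    by (intro diff_mono) (simp_all only: of_nat_le_iff)
  finally show ?thesis
    by simp
qed

lemma (in graph) fixed_loss_le:
  "fixed_loss G \<le> int (card (verts G)) * (2 ^ (card (verts G) - 1) - 1)"
proof -
  let ?S = "{I. independent_set G I \<and> I \<noteq> {}}"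
  have "fixed_loss G \<le> (\<Sum>v\<in>verts G. \<Sum>I | I \<in> ?S \<and> v \<in> I. 2 ^ min_degree_on G I - 1)"
    unfolding fixed_loss_def
  proof (rule sum_le_sum_related)
    show "\<exists>v\<in>verts G. v \<in> I" if "I \<in> ?S" for I
      using that by (auto simp: independent_set_def)
  qed (simp_all add: finite_independent_sets)
  also have "\<dots> = (\<Sum>v\<in>verts G. \<Sum>I | independent_set G I \<and> v \<in> I. 2 ^ min_degree_on G I - 1)"
    by (intro sum.cong) auto
  also have "\<dots> \<le> (\<Sum>v\<in>verts G. 2 ^ (card (verts G) - 1) - 1)"
    by (intro sum_mono loss_containing_le)
  finally show ?thesis
    by simp
qed

lemma complete_digraph_dominates_iff:
  assumes "K\<^bsub>s\<^esub> K"
  shows "u \<rightarrow>\<^bsub>K\<^esub> v \<longleftrightarrow> u \<in> verts K \<and> v \<in> verts K \<and> u \<noteq> v"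
  using assms by (simp add: complete_digraph_def)

lemma out_degree_complete_digraph:
  assumes "K\<^bsub>s\<^esub> K" and "v \<in> verts K"
  shows "out_degree K v = s - 1"
proof -
  interpret graph K
    using assms(1) by (simp add: complete_digraph_def)
  have "{w. v \<rightarrow>\<^bsub>K\<^esub> w} = verts K - {v}"
    using assms by (auto simp: complete_digraph_dominates_iff)
  then show ?thesis
    using assms by (simp add: out_degree_eq_card_neighbours complete_digraph_def)
qed

lemma nonempty_independent_sets_complete_digraph:
  assumes "K\<^bsub>s\<^esub> K"
  shows "{I. independent_set K I \<and> I \<noteq> {}} = (\<lambda>v. {v}) ` verts K"
proof (intro equalityI subsetI)
  fix I
  assume "I \<in> {I. independent_set K I \<and> I \<noteq> {}}"
  then obtain v where "v \<in> I" and "I \<subseteq> verts K" and "\<forall>u\<in>I. \<forall>w\<in>I. u = w"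
    using assms by (fastforce simp: independent_set_def complete_digraph_dominates_iff)
  then have "I = {v}" "v \<in> verts K"
    by blast+
  then show "I \<in> (\<lambda>v. {v}) ` verts K"
    by simp
qed (use assms in \<open>auto simp: independent_set_def complete_digraph_dominates_iff\<close>)

lemma fixed_loss_complete_digraph:
  assumes "K\<^bsub>s\<^esub> K"
  shows "fixed_loss K = int s * (2 ^ (s - 1) - 1)"
proof -
  have "fixed_loss K = (\<Sum>v\<in>verts K. 2 ^ out_degree K v - 1)"
    unfolding fixed_loss_def nonempty_independent_sets_complete_digraph[OF assms]
    by (simp add: sum.reindex min_degree_on_singleton)
  also have "\<dots> = (\<Sum>v\<in>verts K. 2 ^ (s - 1) - 1)"
    using assms by (simp add: out_degree_complete_digraph)
  finally show ?thesis
    using assms by (simp add: complete_digraph_def)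
qed

theorem theorem4p6:
  fixes R :: "('a, 'b) pre_digraph" and K :: "('c, 'd) pre_digraph" and s :: nat
  assumes "graph R" and "card (verts R) = s" and "K\<^bsub>s\<^esub> K"
  shows "fixed_loss R \<le> fixed_loss K \<and> fixed_loss K = int s * (2 ^ (s - 1) - 1)"
proof
  show fixed_loss_K: "fixed_loss K = int s * (2 ^ (s - 1) - 1)"
    using \<open>K\<^bsub>s\<^esub> K\<close> by (rule fixed_loss_complete_digraph)
  have "fixed_loss R \<le> int s * (2 ^ (s - 1) - 1)"
    using graph.fixed_loss_le[OF \<open>graph R\<close>] \<open>card (verts R) = s\<close> by simp
  then show "fixed_loss R \<le> fixed_loss K"
    by (simp only: fixed_loss_K)
qed

end
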